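(* Let $D$ be a finite digraph that is specular and strongly quadrangular. Then $D$ is the digraph of a unitary matrix.
   Context: Throughout, digraphs are finite, may have loops, and are assumed to have no sources (vertices with no ingoing arcs), no sinks (vertices with no outgoing arcs) and no isolated loopless vertices. For $v\in V(D)$, $N^{+}[v]=\{w:(v,w)\in A(D)\}$ and $N^{-}[v]=\{u:(u,v)\in A(D)\}$. $D$ is the digraph of an $n\times n$ matrix $M$ (with $V(D)=\{v_1,\dots,v_n\}$) if $(v_i,v_j)\in A(D)$ exactly when $M_{ij}\neq 0$. $D$ is specular if for any two distinct vertices $v,w$: $N^{+}[v]\cap N^{+}[w]\neq\emptyset$ implies $N^{+}[v]=N^{+}[w]$, and $N^{-}[v]\cap N^{-}[w]\neq\emptyset$ implies $N^{-}[v]=N^{-}[w]$. $D$ is strongly quadrangular if there is no set $S\subseteq V(D)$ such that (a) for every $v\in S$, $N^{+}[v]\cap\bigcup_{w\in S,\,w\neq v}N^{+}[w]\neq\emptyset$, and (b) there is $T\subseteq V(D)$ with $|T|<|S|$ such that $N^{+}[v]\cap N^{+}[w]\subseteq T$ for all distinct $v,w\in S$; and likewise no such $S$ exists with $N^{+}$ replaced by $N^{-}$ throughout. *)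

theory Defs
  imports "Graph_Theory.Pair_Digraph" "Jordan_Normal_Form.Schur_Decomposition"
begin

definition out_nbh :: "'a pair_pre_digraph \<Rightarrow> 'a \<Rightarrow> 'a set" where
  "out_nbh D v = {w. (v, w) \<in> parcs D}"

definition in_nbh :: "'a pair_pre_digraph \<Rightarrow> 'a \<Rightarrow> 'a set" where
  "in_nbh D v = {u. (u, v) \<in> parcs D}"

definition is_source :: "'a pair_pre_digraph \<Rightarrow> 'a \<Rightarrow> bool" where
  "is_source D v \<longleftrightarrow> v \<in> pverts D \<and> in_nbh D v = {}"

definition is_sink :: "'a pair_pre_digraph \<Rightarrow> 'a \<Rightarrow> bool" where
  "is_sink D v \<longleftrightarrow> v \<in> pverts D \<and> out_nbh D v = {}"

definition is_isolated_loopless :: "'a pair_pre_digraph \<Rightarrow> 'a \<Rightarrow> bool" where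
  "is_isolated_loopless D v \<longleftrightarrow>
     v \<in> pverts D \<and> out_nbh D v - {v} = {} \<and> in_nbh D v - {v} = {} \<and> (v, v) \<notin> parcs D"

text \<open>A \<open>pair_fin_digraph\<close> is finite, may have loops and has no parallel arcs.\<close>

locale admissible_digraph = pair_fin_digraph D for D :: "'a pair_pre_digraph" +
  assumes no_source: "\<not> is_source D v"
    and no_sink: "\<not> is_sink D v"
    and no_isolated_loopless: "\<not> is_isolated_loopless D v"

definition specular :: "'a pair_pre_digraph \<Rightarrow> bool" where
  "specular D \<longleftrightarrow>
     (\<forall>v \<in> pverts D. \<forall>w \<in> pverts D. v \<noteq> w \<longrightarrow>
        (out_nbh D v \<inter> out_nbh D w \<noteq> {} \<longrightarrow> out_nbh D v = out_nbh D w) \<and>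
        (in_nbh D v \<inter> in_nbh D w \<noteq> {} \<longrightarrow> in_nbh D v = in_nbh D w))"

definition quadrangularity_violation ::
    "'a set \<Rightarrow> ('a \<Rightarrow> 'a set) \<Rightarrow> 'a set \<Rightarrow> bool" where
  "quadrangularity_violation V N S \<longleftrightarrow>
     S \<subseteq> V \<and>
     (\<forall>v \<in> S. N v \<inter> (\<Union>w \<in> S - {v}. N w) \<noteq> {}) \<and>
     (\<exists>T. T \<subseteq> V \<and> card T < card S \<and>
        (\<forall>v \<in> S. \<forall>w \<in> S. v \<noteq> w \<longrightarrow> N v \<inter> N w \<subseteq> T))"

definition strongly_quadrangular :: "'a pair_pre_digraph \<Rightarrow> bool" where
  "strongly_quadrangular D \<longleftrightarrow>
     (\<nexists>S. quadrangularity_violation (pverts D) (out_nbh D) S) \<and>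
     (\<nexists>S. quadrangularity_violation (pverts D) (in_nbh D) S)"

definition is_digraph_of :: "'a pair_pre_digraph \<Rightarrow> 'b::zero mat \<Rightarrow> bool" where
  "is_digraph_of D M \<longleftrightarrow>
     square_mat M \<and>
     (\<exists>v. bij_betw v {..<dim_row M} (pverts D) \<and>
        (\<forall>i < dim_row M. \<forall>j < dim_row M. (v i, v j) \<in> parcs D \<longleftrightarrow> M $$ (i, j) \<noteq> 0))"

definition unitary_mat :: "complex mat \<Rightarrow> bool" where
  "unitary_mat U \<longleftrightarrow>
     square_mat U \<and>
     mat_adjoint U * U = 1\<^sub>m (dim_row U) \<and> U * mat_adjoint U = 1\<^sub>m (dim_row U)"

end

theory Submission
  imports Defs
begin

text \<open>
  By specularity the arcs split into complete bipartite blocks \<open>C \<times> N\<close>, where \<open>C\<close> is the set of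
  all vertices with out-neighbourhood \<open>N\<close>. Applying strong quadrangularity to \<open>S = C\<close>, \<open>T = N\<close>
  and, for in-neighbourhoods, to \<open>S = N\<close>, \<open>T = C\<close> shows that these blocks are square. It then
  suffices to fill each \<open>m \<times> m\<close> block with a unitary matrix without zero entries, for which
  \<open>I - c J\<close> with \<open>c = (1 + \<i>) / m\<close> and \<open>J\<close> the all-ones matrix is a choice that works for every
  \<open>m \<ge> 1\<close>.
\<close>

text \<open>If \<open>C\<close> were larger than the nonempty set \<open>B\<close>, it would have at
  least two members, so each would share all of \<open>B\<close> with another one, and
  \<open>T = B\<close> would make \<open>C\<close> a violation.\<close>

lemma common_nbh_card_le:
  assumes viol: "\<nexists>S. quadrangularity_violation V N S"
    and "finite V" "C \<subseteq> V" "B \<subseteq> V" "B \<noteq> {}"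
    and common: "\<And>v. v \<in> C \<Longrightarrow> N v = B"
  shows "card C \<le> card B"
proof (rule ccontr)
  assume less: "\<not> card C \<le> card B"
  have "finite B" using assms(2,4) finite_subset by blast
  with \<open>B \<noteq> {}\<close> have "card B > 0" by (simp add: card_gt_0_iff)
  with less have two: "\<not> card C \<le> Suc 0" by linarith
  have "C - {v} \<noteq> {}" for v
  proof
    assume "C - {v} = {}"
    then have "C \<subseteq> {v}" by blast
    then have "card C \<le> card {v}" by (intro card_mono) auto
    with two show False by simp
  qed
  then have "\<forall>v\<in>C. N v \<inter> (\<Union>w\<in>C - {v}. N w) \<noteq> {}"
    using common \<open>B \<noteq> {}\<close> by fastforce
  then have "quadrangularity_violation V N C"
    unfolding quadrangularity_violation_def
    using less assms(3,4) common by (intro conjI exI[of _ B]) auto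
  with viol show False by blast
qed

text \<open>These are inner products of rows of \<open>I - c J\<close>. Expanding leaves the
  indicator of \<open>a = b\<close> plus \<open>card N * (c * cnj c) - c - cnj c\<close>, which the
  condition on \<open>c\<close> cancels.\<close>

lemma sum_indicator_shift:
  fixes c :: complex
  assumes "finite N" "a \<in> N" "b \<in> N" and c: "c + cnj c = of_nat (card N) * (c * cnj c)"
  shows "(\<Sum>w\<in>N. ((if w = a then 1 else 0) - c) * cnj ((if w = b then 1 else 0) - c)) =
    (if a = b then 1 else 0)"
proof -
  have "(\<Sum>w\<in>N. ((if w = a then 1 else 0) - c) * cnj ((if w = b then 1 else 0) - c)) =
    (\<Sum>w\<in>N. (if w = a then (if a = b then 1 else 0) else 0) - (if w = a then cnj c else 0)
       - (if w = b then c else 0) + c * cnj c)"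
    by (intro sum.cong) (auto simp: algebra_simps)
  also have "\<dots> = (if a = b then 1 else 0) - cnj c - c + of_nat (card N) * (c * cnj c)"
    using assms(1-3) by (simp add: sum.distrib sum_subtractf)
  also have "\<dots> = (if a = b then 1 else 0)" by (simp flip: c)
  finally show ?thesis .
qed

text \<open>The map \<open>s\<close> matches rows to columns within each block, which fixes where
  the identity part of \<open>I - c J\<close> has its ones.\<close>

lemma (in admissible_digraph) ex_arc_permutation:
  assumes "specular D" "strongly_quadrangular D"
  obtains s where "\<And>v. v \<in> pverts D \<Longrightarrow> (v, s v) \<in> parcs D" "inj_on s (pverts D)"
proof -
  let ?V = "pverts D" and ?N = "out_nbh D"
  have out_eq: "?N v = ?N w" if "v \<in> ?V" "w \<in> ?V" "u \<in> ?N v" "u \<in> ?N w" for u v w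
    using assms(1)[unfolded specular_def, rule_format, OF that(1,2)] that(3,4) by auto
  have out_V: "?N v \<subseteq> ?V" for v by (auto simp: out_nbh_def dest: in_arcsD2)
  have in_V: "in_nbh D v \<subseteq> ?V" for v by (auto simp: in_nbh_def dest: in_arcsD1)
  have "\<exists>f. bij_betw f {w \<in> ?V. ?N w = ?N v} (?N v)" if v: "v \<in> ?V" for v
  proof -
    let ?C = "{w \<in> ?V. ?N w = ?N v}"
    have ne: "?N v \<noteq> {}" using no_sink[of v] v by (auto simp: is_sink_def)
    have "card ?C \<le> card (?N v)"
      using assms(2) ne out_V unfolding strongly_quadrangular_def
      by (intro common_nbh_card_le[of ?V ?N]) auto
    \<comment> \<open>Any in-neighbour of \<open>u\<close> shares \<open>u\<close> with
      \<open>v\<close>, so specularity puts it in \<open>?C\<close>. Hence \<open>?C\<close> is a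
      common in-neighbourhood and the count also works in reverse.\<close>
    moreover have "in_nbh D u = ?C" if "u \<in> ?N v" for u
    proof -
      have "w \<in> ?C" if "w \<in> in_nbh D u" for w
        using out_eq[of w v u] v that \<open>u \<in> ?N v\<close> in_V by (auto simp: in_nbh_def out_nbh_def)
      moreover have "w \<in> in_nbh D u" if "w \<in> ?C" for w
        using that \<open>u \<in> ?N v\<close> by (auto simp: in_nbh_def out_nbh_def)
      ultimately show ?thesis by blast
    qed
    then have "card (?N v) \<le> card ?C"
      using assms(2) v out_V unfolding strongly_quadrangular_def
      by (intro common_nbh_card_le[of ?V "in_nbh D"]) auto
    ultimately show ?thesis
      using finite_subset[OF out_V] by (intro finite_same_card_bij) auto
  qed
  \<comment> \<open>Choosing one bijection per neighbourhood \<open>B\<close>, not per vertex, lets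
    all rows of a block use the same one; injectivity of \<open>s\<close> rests on this.\<close>
  then have "\<exists>f. bij_betw f {w \<in> ?V. ?N w = B} B" if "B \<in> ?N ` ?V" for B
    using that by auto
  then obtain F where F: "\<And>B. B \<in> ?N ` ?V \<Longrightarrow> bij_betw (F B) {w \<in> ?V. ?N w = B} B"
    by metis
  define s where "s v = F (?N v) v" for v
  have mem: "s v \<in> ?N v" if "v \<in> ?V" for v
    using bij_betwE[OF F[of "?N v"]] that by (auto simp: s_def)
  have "inj_on s ?V"
  proof (rule inj_onI)
    fix v w assume vw: "v \<in> ?V" "w \<in> ?V" and eq: "s v = s w"
    have N: "?N v = ?N w" using out_eq[OF vw] mem[OF vw(1)] mem[OF vw(2)] eq by auto
    have "inj_on (F (?N v)) {u \<in> ?V. ?N u = ?N v}"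
      using F[of "?N v"] vw by (auto simp: bij_betw_def)
    then show "v = w" using eq N vw by (auto simp: s_def dest: inj_onD)
  qed
  with mem that show ?thesis by (auto simp: out_nbh_def)
qed

text \<open>Orthonormal rows make the adjoint a right inverse, and for square matrices a right
  inverse is also a left inverse.\<close>

lemma unitary_mat_if_rows_orthonormal:
  assumes orth: "\<And>i k. i < n \<Longrightarrow> k < n \<Longrightarrow>
      (\<Sum>j<n. f i j * cnj (f k j)) = (if i = k then 1 else 0)"
  shows "unitary_mat (mat n n (\<lambda>(i, j). f i j))"
proof -
  let ?U = "mat n n (\<lambda>(i, j). f i j)"
  have U: "?U \<in> carrier_mat n n" by simp
  have adj: "mat_adjoint ?U = mat n n (\<lambda>(j, k). cnj (f k j))"
    unfolding mat_adjoint_def by (rule eq_matI) (auto simp: mat_of_rows_def)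
  have right: "?U * mat_adjoint ?U = 1\<^sub>m n"
    unfolding adj by (rule eq_matI) (auto simp: scalar_prod_def orth atLeast0LessThan)
  have "mat_adjoint ?U * ?U = 1\<^sub>m n"
    by (rule mat_mult_left_right_inverse[OF U _ right]) (simp add: adj)
  with right show ?thesis by (simp add: unitary_mat_def)
qed

theorem theorem11:
  fixes D :: "'a pair_pre_digraph"
  assumes "admissible_digraph D"
    and "specular D"
    and "strongly_quadrangular D"
  shows "\<exists>U :: complex mat. unitary_mat U \<and> is_digraph_of D U"
proof -
  interpret admissible_digraph D by fact
  let ?V = "pverts D" and ?N = "out_nbh D"
  obtain s where s: "\<And>v. v \<in> ?V \<Longrightarrow> (v, s v) \<in> parcs D" and inj: "inj_on s ?V"
    using ex_arc_permutation assms(2,3) by blast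
  have out_V: "?N v \<subseteq> ?V" for v by (auto simp: out_nbh_def dest: in_arcsD2)
  \<comment> \<open>With \<open>m = card (?N v)\<close>, both sides of \<open>c_eq\<close> are
    \<open>2 / m\<close>. The nonzero imaginary part keeps \<open>- c v\<close> and
    \<open>1 - c v\<close> from vanishing; the real choice \<open>2 / m\<close> would give a zero at
    \<open>m = 2\<close>.\<close>
  define c where "c v = Complex (1 / card (?N v)) (1 / card (?N v))" for v
  define g where "g v w = (if (v, w) \<in> parcs D then (if w = s v then 1 else 0) - c v else 0)"
    for v w
  have card_pos: "card (?N v) > 0" if "v \<in> ?V" for v
    using s[OF that] finite_subset[OF out_V] by (auto simp: card_gt_0_iff out_nbh_def)
  have c_eq: "c v + cnj (c v) = of_nat (card (?N v)) * (c v * cnj (c v))" if "v \<in> ?V" for v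
    using card_pos[OF that] by (simp add: c_def complex_eq_iff field_simps)
  have g_nz: "g v w \<noteq> 0 \<longleftrightarrow> (v, w) \<in> parcs D" if "v \<in> ?V" for v w
    using card_pos[OF that] by (auto simp: g_def c_def complex_eq_iff)
  have orth: "(\<Sum>w\<in>?V. g v w * cnj (g v' w)) = (if v = v' then 1 else 0)"
    if v: "v \<in> ?V" "v' \<in> ?V" for v v'
  proof (cases "?N v = ?N v'")
    case True
    then have "(v', w) \<in> parcs D \<longleftrightarrow> (v, w) \<in> parcs D" for w by (auto simp: out_nbh_def)
    moreover have "c v' = c v" using True by (simp add: c_def)
    ultimately have "(\<Sum>w\<in>?V. g v w * cnj (g v' w)) = (\<Sum>w\<in>?N v.
        ((if w = s v then 1 else 0) - c v) * cnj ((if w = s v' then 1 else 0) - c v))"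
      using out_V by (intro sum.mono_neutral_cong_right) (auto simp: g_def out_nbh_def)
    also have "\<dots> = (if s v = s v' then 1 else 0)"
      using finite_subset[OF out_V] s[OF v(1)] s[OF v(2)] True
      by (intro sum_indicator_shift c_eq v(1)) (auto simp: out_nbh_def)
    also have "s v = s v' \<longleftrightarrow> v = v'" using inj v by (auto dest: inj_onD)
    finally show ?thesis .
  next
    case False
    have "v \<noteq> v'" using False by auto
    \<comment> \<open>Rows from different blocks have disjoint supports, so every summand
      vanishes.\<close>
    then have "?N v \<inter> ?N v' = {}"
      using assms(2)[unfolded specular_def, rule_format, OF v] False by auto
    then have "g v w * cnj (g v' w) = 0" for w by (simp add: g_def out_nbh_def disjoint_iff)
    then have "(\<Sum>w\<in>?V. g v w * cnj (g v' w)) = 0" by (intro sum.neutral ballI)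
    with \<open>v \<noteq> v'\<close> show ?thesis by (simp only: if_False)
  qed
  obtain e where e: "bij_betw e {..<card ?V} ?V"
    using ex_bij_betw_nat_finite[OF finite_verts] by (auto simp: atLeast0LessThan)
  have eV: "e i \<in> ?V" if "i < card ?V" for i using bij_betwE[OF e] that by auto
  define U where "U = mat (card ?V) (card ?V) (\<lambda>(i, j). g (e i) (e j))"
  have "unitary_mat U" unfolding U_def
  proof (rule unitary_mat_if_rows_orthonormal)
    fix i k assume ik: "i < card ?V" "k < card ?V"
    have "e i = e k \<longleftrightarrow> i = k" using e ik by (auto simp: bij_betw_def dest: inj_onD)
    then show "(\<Sum>j<card ?V. g (e i) (e j) * cnj (g (e k) (e j))) = (if i = k then 1 else 0)"
      using orth[OF eV eV, OF ik]
        sum.reindex_bij_betw[OF e, of "\<lambda>w. g (e i) w * cnj (g (e k) w)"] by simp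
  qed
  moreover have "is_digraph_of D U"
    unfolding is_digraph_of_def using e g_nz eV by (auto simp: U_def)
  ultimately show ?thesis by blast
qed

end
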